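(* Let $\lambda\in\mathbb{C}$ with $\lambda\neq1$ and let $a$ be a non-negative integer. For $n\in\mathbb{N}$ (that is, $n\ge1$), $$x\,H_{n-1}^{(an)}(x|\lambda)\sim\left(1,\;t\left(\frac{e^t-\lambda}{1-\lambda}\right)^a\right),$$ i.e. for every $n\ge1$ the $n$-th polynomial of the associated sequence for the delta series $t\left(\frac{e^t-\lambda}{1-\lambda}\right)^a$ is $x\,H_{n-1}^{(an)}(x|\lambda)$.
   Context: Let $\mathbb{P}=\mathbb{C}[x]$ and let $\mathcal{F}$ be the algebra of formal power series in $t$ over $\mathbb{C}$. A series $f(t)=\sum_{k\ge0}\frac{a_k}{k!}t^k\in\mathcal{F}$ acts as a linear functional on $\mathbb{P}$ by $\langle f(t)\mid x^n\rangle=a_n$ for $n\ge0$. A delta series is a series with zero constant term and nonzero coefficient of $t$; an invertible series is one with nonzero constant term. For an invertible series $g(t)$ and a delta series $f(t)$ there is a unique sequence of polynomials $S_n(x)$ ($n\ge0$) with $\langle g(t)f(t)^k\mid S_n(x)\rangle=n!\,\delta_{n,k}$ for all $n,k\ge0$; it is called the Sheffer sequence for $(g(t),f(t))$, written $S_n(x)\sim(g(t),f(t))$. If $g(t)=1$, it is called the associated sequence for $f(t)$. The Frobenius-Euler polynomials of order $\alpha$ are defined by $\left(\frac{1-\lambda}{e^t-\lambda}\right)^{\alpha}e^{xt}=\sum_{n\ge0}H_n^{(\alpha)}(x|\lambda)\frac{t^n}{n!}$. *)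

theory Defs
  imports Complex_Main "HOL-Computational_Algebra.Polynomial"
    "HOL-Computational_Algebra.Formal_Power_Series"
begin

section \<open>Power series as linear functionals on polynomials\<close>

definition umbral_pairing :: "complex fps \<Rightarrow> complex poly \<Rightarrow> complex" where
  "umbral_pairing f p = (\<Sum>k\<le>degree p. coeff p k * (fact k * fps_nth f k))"

definition delta_series :: "complex fps \<Rightarrow> bool" where
  "delta_series f \<longleftrightarrow> fps_nth f 0 = 0 \<and> fps_nth f 1 \<noteq> 0"

definition invertible_series :: "complex fps \<Rightarrow> bool" where
  "invertible_series g \<longleftrightarrow> fps_nth g 0 \<noteq> 0"

lemma umbral_pairing_eq:
  assumes "degree p \<le> N"
  shows "umbral_pairing f p = (\<Sum>k\<le>N. coeff p k * (fact k * fps_nth f k))"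
  unfolding umbral_pairing_def using assms
  by (intro sum.mono_neutral_left) (auto simp: coeff_eq_0)

lemma umbral_pairing_monom: "umbral_pairing f (monom 1 n) = fact n * fps_nth f n"
proof -
  have "umbral_pairing f (monom 1 n) = (\<Sum>k\<le>n. if k = n then fact k * fps_nth f k else 0)"
    unfolding umbral_pairing_eq[OF degree_monom_le] by (intro sum.cong) auto
  thus ?thesis by (simp add: if_distrib cong: if_cong)
qed

lemma umbral_pairing_add: "umbral_pairing f (p + q) = umbral_pairing f p + umbral_pairing f q"
proof -
  define N where "N = max (degree p) (degree q)"
  have "degree p \<le> N" "degree q \<le> N" "degree (p + q) \<le> N"
    using degree_add_le_max[of p q] by (auto simp: N_def)
  thus ?thesis
    by (simp add: umbral_pairing_eq[of _ N] sum.distrib ring_distribs)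
qed

lemma umbral_pairing_smult: "umbral_pairing f (smult c p) = c * umbral_pairing f p"
  by (subst umbral_pairing_eq[of _ "degree p"])
     (auto simp: umbral_pairing_def sum_distrib_left mult.assoc)


section \<open>Sheffer sequences\<close>

definition is_sheffer_sequence ::
  "complex fps \<Rightarrow> complex fps \<Rightarrow> (nat \<Rightarrow> complex poly) \<Rightarrow> bool" where
  "is_sheffer_sequence g f S \<longleftrightarrow>
     (\<forall>n k. umbral_pairing (g * f ^ k) (S n) = (if n = k then fact n else 0))"

text \<open>Existence and uniqueness, for invertible \<open>g\<close> and delta \<open>f\<close>, are established
  in \<open>sheffer_sequence_ex1\<close> below.\<close>

definition sheffer_sequence :: "complex fps \<Rightarrow> complex fps \<Rightarrow> nat \<Rightarrow> complex poly" where
  "sheffer_sequence g f = (THE S. is_sheffer_sequence g f S)"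

definition associated_sequence :: "complex fps \<Rightarrow> nat \<Rightarrow> complex poly" where
  "associated_sequence f = sheffer_sequence 1 f"

lemma delta_power_nth:
  assumes "delta_series f"
  shows "j < k \<Longrightarrow> fps_nth (g * f ^ k) j = 0"
    and "fps_nth (g * f ^ k) k = fps_nth g 0 * fps_nth f 1 ^ k"
proof -
  define h where "h = fps_shift 1 f"
  have f: "f = fps_X * h"
    using assms by (intro fps_ext) (auto simp: h_def delta_series_def)
  have eq: "g * f ^ k = fps_X ^ k * (g * h ^ k)"
    by (simp add: f power_mult_distrib mult_ac)
  show "j < k \<Longrightarrow> fps_nth (g * f ^ k) j = 0"
    unfolding eq by (simp add: fps_X_power_mult_nth)
  show "fps_nth (g * f ^ k) k = fps_nth g 0 * fps_nth f 1 ^ k"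
    unfolding eq by (simp add: fps_X_power_mult_nth h_def fps_power_zeroth)
qed

lemma sheffer_sequence_ex1:
  assumes g: "invertible_series g" and f: "delta_series f"
  shows "\<exists>!S. is_sheffer_sequence g f S"
proof -
  have nz: "fps_nth (g * f ^ k) k \<noteq> 0" for k
    using assms delta_power_nth(2)[OF f] by (simp add: delta_series_def invertible_series_def)
  have high: "umbral_pairing (g * f ^ k) p = 0" if "degree p < k" for k p
    unfolding umbral_pairing_def using that delta_power_nth(1)[OF f]
    by (intro sum.neutral) auto
  have top: "umbral_pairing (g * f ^ k) p = coeff p k * (fact k * fps_nth (g * f ^ k) k)"
    if "degree p \<le> k" for k p
  proof -
    have "umbral_pairing (g * f ^ k) p =
        (\<Sum>j\<in>{k}. coeff p j * (fact j * fps_nth (g * f ^ k) j))"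
      unfolding umbral_pairing_eq[OF that] using delta_power_nth(1)[OF f]
      by (intro sum.mono_neutral_right) auto
    thus ?thesis by simp
  qed
  have zero: "p = 0" if "\<And>k. umbral_pairing (g * f ^ k) p = 0" for p
    using that[of "degree p"] top[of p "degree p"] nz[of "degree p"] by simp
  have ex: "\<exists>p. degree p \<le> n \<and> (\<forall>k\<le>n. umbral_pairing (g * f ^ k) p = b k)" for n b
  proof (induction n arbitrary: b)
    case 0
    show ?case
      by (rule exI[of _ "[:b 0 / fps_nth (g * f ^ 0) 0:]"])
         (use nz[of 0] in \<open>auto simp: umbral_pairing_def\<close>)
  next
    case (Suc n)
    define c where "c = b (Suc n) / (fact (Suc n) * fps_nth (g * f ^ Suc n) (Suc n))"
    obtain q where q: "degree q \<le> n"
      "\<And>k. k \<le> n \<Longrightarrow> umbral_pairing (g * f ^ k) q =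
              b k - umbral_pairing (g * f ^ k) (monom c (Suc n))"
      using Suc.IH[of "\<lambda>k. b k - umbral_pairing (g * f ^ k) (monom c (Suc n))"] by blast
    have deg: "degree (monom c (Suc n) + q) \<le> Suc n"
      using q(1) by (intro degree_add_le degree_monom_le) auto
    have "umbral_pairing (g * f ^ k) (monom c (Suc n) + q) = b k" if "k \<le> Suc n" for k
    proof (cases "k = Suc n")
      case True
      have "umbral_pairing (g * f ^ Suc n) (monom c (Suc n) + q) =
              c * (fact (Suc n) * fps_nth (g * f ^ Suc n) (Suc n))"
        using top[OF deg] q(1) by (simp add: coeff_eq_0 del: power_Suc fact_Suc)
      also have "\<dots> = b (Suc n)"
        using nz[of "Suc n"] unfolding c_def by (simp del: power_Suc fact_Suc)
      finally show ?thesis using True by simp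
    next
      case False
      thus ?thesis using that q(2)[of k] by (simp add: umbral_pairing_add)
    qed
    thus ?case using deg by blast
  qed
  have "\<exists>p. \<forall>k. umbral_pairing (g * f ^ k) p = (if n = k then fact n else 0)" for n
  proof -
    obtain p where p: "degree p \<le> n"
        "\<And>k. k \<le> n \<Longrightarrow> umbral_pairing (g * f ^ k) p = (if n = k then fact n else 0)"
      using ex[of n "\<lambda>k. if n = k then fact n else 0"] by blast
    have "umbral_pairing (g * f ^ k) p = (if n = k then fact n else 0)" for k
      using p high[of p k] by (cases "k \<le> n") auto
    thus ?thesis by blast
  qed
  hence "\<exists>S. is_sheffer_sequence g f S"
    unfolding is_sheffer_sequence_def by metis
  moreover have "S = T" if "is_sheffer_sequence g f S" "is_sheffer_sequence g f T" for S T
  proof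
    fix n
    have "umbral_pairing (g * f ^ k) (S n + smult (-1) (T n)) = 0" for k
      using that unfolding is_sheffer_sequence_def
      by (simp only: umbral_pairing_add umbral_pairing_smult) simp
    from zero[OF this] show "S n = T n" by simp
  qed
  ultimately show ?thesis by blast
qed

lemma sheffer_sequence_eqI:
  assumes "invertible_series g" "delta_series f" "is_sheffer_sequence g f S"
  shows "sheffer_sequence g f = S"
  unfolding sheffer_sequence_def
  using assms sheffer_sequence_ex1[of g f] by (intro the1_equality)


section \<open>Frobenius-Euler polynomials\<close>

text \<open>\<open>F\<^sup>\<alpha>\<close> for a series \<open>F\<close> with constant term 1, by the binomial series in \<open>F - 1\<close>.\<close>

definition fps_cpow :: "complex fps \<Rightarrow> complex \<Rightarrow> complex fps" where
  "fps_cpow F \<alpha> = fps_compose (fps_binomial \<alpha>) (F - 1)"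

lemma fps_cpow_of_nat:
  assumes "fps_nth F 0 = 1"
  shows "fps_cpow F (of_nat r) = F ^ r"
proof -
  have "fps_cpow F (of_nat r) = fps_compose ((1 + fps_X) ^ r) (F - 1)"
    by (simp add: fps_cpow_def fps_binomial_of_nat)
  also have "\<dots> = (fps_compose (1 + fps_X) (F - 1)) ^ r"
    using assms by (subst fps_compose_power) simp_all
  also have "fps_compose (1 + fps_X) (F - 1) = F"
    using assms by (simp add: fps_compose_add_distrib)
  finally show ?thesis .
qed

text \<open>The generating function is an element of \<open>\<complex>[x][[t]]\<close>: the first factor is
  \<open>((1 - \<lambda>) / (e\<^sup>t - \<lambda>))\<^sup>\<alpha>\<close> with its coefficients viewed as constant polynomials, the second
  is \<open>e\<^sup>x\<^sup>t\<close>.  Its base has constant term 1 precisely because \<open>\<lambda> \<noteq> 1\<close>.\<close>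

definition frobenius_euler_gf :: "complex \<Rightarrow> complex \<Rightarrow> complex poly fps" where
  "frobenius_euler_gf \<alpha> l =
     Abs_fps (\<lambda>k. [:fps_nth (fps_cpow (fps_const (1 - l) / (fps_exp 1 - fps_const l)) \<alpha>) k:]) *
     Abs_fps (\<lambda>k. monom (1 / fact k) k)"

definition frobenius_euler :: "complex \<Rightarrow> complex \<Rightarrow> nat \<Rightarrow> complex poly" where
  "frobenius_euler \<alpha> l n = smult (fact n) (fps_nth (frobenius_euler_gf \<alpha> l) n)"

lemma frobenius_euler_of_nat:
  assumes "l \<noteq> 1"
  shows "poly (frobenius_euler (of_nat r) l n) x =
    fact n * fps_nth ((fps_const (1 - l) / (fps_exp 1 - fps_const l)) ^ r * fps_exp x) n"
proof -
  have "fps_nth (fps_const (1 - l) / (fps_exp 1 - fps_const l)) 0 = 1"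
    using assms by (simp add: fps_divide_unit)
  from fps_cpow_of_nat[OF this] show ?thesis
    by (simp add: frobenius_euler_def frobenius_euler_gf_def fps_mult_nth poly_sum poly_monom)
qed

end

theory Submission
  imports Defs
begin

text \<open>
  Write the delta series as \<open>f = t h\<close> with \<open>h = ((e\<^sup>t - \<lambda>) / (1 - \<lambda>))\<^sup>a\<close>.  Multiplication by
  \<open>x\<close> is adjoint to differentiation of the functional (\<open>umbral_pairing_X_mult\<close>), and pairing
  with the Appell polynomial \<open>H\<^sub>N\<close> of a series \<open>G\<close>, generated by \<open>G(t) e\<^sup>x\<^sup>t\<close>, reads
  off the coefficient of \<open>t\<^sup>N\<close> after multiplication by \<open>G\<close> (\<open>umbral_pairing_appell\<close>).
  For the polynomial in question, \<open>G\<close> is \<open>h\<^sup>-\<^sup>n\<close> and \<open>N = n - 1\<close>, so its pairing with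
  \<open>f\<^sup>k\<close> is \<open>(n - 1)!\<close> times the coefficient of \<open>t\<^sup>n\<^sup>-\<^sup>1\<close> in \<open>h\<^sup>-\<^sup>n (f\<^sup>k)'\<close>.

  That coefficient is the residue of \<open>f\<^sup>-\<^sup>n (f\<^sup>k)'\<close>.  For \<open>k \<noteq> n\<close> the Laurent series is
  a multiple of the derivative of \<open>f\<^sup>k\<^sup>-\<^sup>n\<close> and has residue \<open>0\<close>; for \<open>k = n\<close> it is
  \<open>n f'/f\<close>, whose residue is \<open>n\<close> because \<open>f\<close> has a simple zero
  (\<open>fps_power_deriv_residue\<close>).  This is the orthogonality that characterizes the
  associated sequence.
\<close>

lemma umbral_pairing_X_mult:
  "umbral_pairing f ([:0, 1:] * p) = umbral_pairing (fps_deriv f) p"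
proof -
  have "umbral_pairing f ([:0, 1:] * p) =
      (\<Sum>k\<le>Suc (degree p). coeff (pCons 0 p) k * (fact k * fps_nth f k))"
    using degree_pCons_le[of 0 p] by (simp add: umbral_pairing_eq del: sum.atMost_Suc)
  also have "\<dots> = (\<Sum>k\<le>degree p. coeff p k * (fact (Suc k) * fps_nth f (Suc k)))"
    by (subst sum.atMost_Suc_shift) simp
  also have "\<dots> = umbral_pairing (fps_deriv f) p"
    by (simp add: umbral_pairing_def mult_ac)
  finally show ?thesis .
qed

text \<open>The polynomial \<open>p\<close> is the \<open>N\<close>-th Appell polynomial of \<open>G\<close>.  The factorials in its
  coefficients cancel those in the pairing, which leaves a Cauchy product.\<close>

lemma umbral_pairing_appell:
  assumes "\<And>j. coeff p j = (if j \<le> N then fact N / fact j * fps_nth G (N - j) else 0)"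
  shows "umbral_pairing f p = fact N * fps_nth (G * f) N"
proof -
  have "degree p \<le> N"
    using assms by (intro degree_le) auto
  then have "umbral_pairing f p = (\<Sum>j\<le>N. fact N * (fps_nth f j * fps_nth G (N - j)))"
    by (subst umbral_pairing_eq) (auto simp: assms intro!: sum.cong)
  also have "\<dots> = fact N * fps_nth (f * G) N"
    by (simp add: fps_mult_nth sum_distrib_left atMost_atLeast0)
  finally show ?thesis
    by (simp add: mult.commute)
qed

lemma coeff_frobenius_euler_of_nat:
  assumes "l \<noteq> 1"
  shows "coeff (frobenius_euler (of_nat r) l n) j =
    (if j \<le> n then fact n / fact j *
       fps_nth (inverse ((fps_exp 1 - fps_const l) / fps_const (1 - l)) ^ r) (n - j) else 0)"
proof -
  define G where "G = fps_const (1 - l) / (fps_exp 1 - fps_const l)"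
  have "fps_nth G 0 = 1"
    using assms by (simp add: G_def fps_divide_unit)
  then have cpow: "fps_cpow G (of_nat r) = G ^ r"
    by (rule fps_cpow_of_nat)
  have G: "G = inverse ((fps_exp 1 - fps_const l) / fps_const (1 - l))"
    using assms
    by (simp add: G_def fps_divide_unit fps_inverse_mult fps_const_inverse mult.commute)
  have "coeff (frobenius_euler (of_nat r) l n) j =
      fact n * (\<Sum>i\<in>{0..n}. if n - i = j then fps_nth (G ^ r) i / fact j else 0)"
    unfolding frobenius_euler_def frobenius_euler_gf_def G_def[symmetric] cpow
    by (auto simp: fps_mult_nth coeff_sum intro!: sum.cong)
  also have "(\<Sum>i\<in>{0..n}. if n - i = j then fps_nth (G ^ r) i / fact j else 0) =
      (\<Sum>i\<in>{0..n}. if i = n - j then (if j \<le> n then fps_nth (G ^ r) i / fact j else 0) else 0)"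
    by (intro sum.cong) auto
  also have "\<dots> = (if j \<le> n then fps_nth (G ^ r) (n - j) / fact j else 0)"
    by (subst sum.delta) auto
  finally show ?thesis
    unfolding G by simp
qed

text \<open>This computes the residue of \<open>f\<^sup>-\<^sup>n (f\<^sup>k)'\<close> for \<open>f = t h\<close>, in power series form: the
  factor \<open>t\<^sup>-\<^sup>n\<close> is split off and the residue becomes a coefficient of index \<open>n - 1\<close>.\<close>

lemma fps_power_deriv_residue:
  fixes h :: "'a :: field_char_0 fps"
  assumes h: "fps_nth h 0 \<noteq> 0" and n: "n \<ge> 1"
  shows "fps_nth (inverse h ^ n * fps_deriv ((fps_X * h) ^ k)) (n - 1) =
    (if n = k then of_nat n else 0)"
proof (cases k)
  case 0
  then show ?thesis using n by simp
next
  case (Suc k')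
  define u where "u = inverse h"
  have uh: "u * h = 1"
    using h by (simp add: u_def inverse_mult_eq_1)
  have du: "fps_deriv u = - fps_deriv h * u\<^sup>2"
    using h unfolding u_def by (rule fps_inverse_deriv)
  have expand: "u ^ n * fps_deriv ((fps_X * h) ^ k) =
      fps_X ^ k' * (of_nat k * (u ^ n * h ^ k' * (h + fps_X * fps_deriv h)))"
  proof -
    have "fps_deriv ((fps_X * h) ^ k) = of_nat k * fps_deriv (fps_X * h) * (fps_X * h) ^ k'"
      by (simp only: fps_deriv_power fps_of_nat Suc diff_Suc_1)
    also have "fps_deriv (fps_X * h) = h + fps_X * fps_deriv h"
      by (simp add: add.commute)
    finally show ?thesis
      by (simp only: power_mult_distrib mult_ac)
  qed
  consider "k > n" | "k = n" | "k < n" by linarith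
  then show ?thesis
  proof cases
    case 1
    then show ?thesis
      using Suc n unfolding u_def[symmetric] expand by (simp add: fps_X_power_mult_nth)
  next
    case 2
    have "u ^ n * h ^ k' * (h + fps_X * fps_deriv h) =
        (u * h) ^ k' * (u * h + fps_X * (u * fps_deriv h))"
      by (simp add: 2[symmetric] Suc power_mult_distrib algebra_simps)
    then show ?thesis
      using 2 Suc unfolding u_def[symmetric] expand
      by (simp add: uh fps_X_power_mult_nth fps_of_nat[symmetric] del: of_nat_Suc)
  next
    case 3
    define m where "m = n - k"
    have m: "m > 0" "n = k' + 1 + m"
      using 3 Suc by (auto simp: m_def)
    have "u ^ n * h ^ k' * (h + fps_X * fps_deriv h) =
        (u * h) ^ k' * (u ^ m * (u * h) + fps_X * (u ^ Suc m * fps_deriv h))"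
      by (simp add: m(2) power_add power_mult_distrib algebra_simps)
    also have "\<dots> = u ^ m + fps_X * (u ^ Suc m * fps_deriv h)"
      by (simp add: uh)
    finally have body: "u ^ n * h ^ k' * (h + fps_X * fps_deriv h) =
        u ^ m + fps_X * (u ^ Suc m * fps_deriv h)" .
    \<comment> \<open>The right-hand side is \<open>u\<^sup>m - (t/m) (u\<^sup>m)'\<close>, and \<open>t d/dt\<close> scales the coefficient of
      \<open>t\<^sup>m\<close> by \<open>m\<close>, so that coefficient cancels.\<close>
    have "fps_deriv (u ^ m) = - of_nat m * (u ^ Suc m * fps_deriv h)"
    proof -
      have "fps_deriv (u ^ m) = of_nat m * fps_deriv u * u ^ (m - 1)"
        by (simp only: fps_deriv_power fps_of_nat)
      moreover have "u ^ Suc m = u\<^sup>2 * u ^ (m - 1)"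
        using m(1) by (cases m) (simp_all add: power2_eq_square)
      ultimately show ?thesis
        by (simp add: du mult_ac del: power_Suc)
    qed
    then have "fps_nth (fps_deriv (u ^ m)) (m - 1) =
        - of_nat m * fps_nth (u ^ Suc m * fps_deriv h) (m - 1)"
      by (simp add: fps_of_nat[symmetric] del: power_Suc)
    moreover have "fps_nth (fps_deriv (u ^ m)) (m - 1) = of_nat m * fps_nth (u ^ m) m"
      using m(1) by simp
    ultimately have "of_nat m * (fps_nth (u ^ m) m +
        fps_nth (u ^ Suc m * fps_deriv h) (m - 1)) = 0"
      by (simp only: distrib_left mult_minus_left left_minus)
    then have "fps_nth (u ^ m + fps_X * (u ^ Suc m * fps_deriv h)) m = 0"
      using m(1) by (simp del: power_Suc)
    moreover have "n - 1 = k' + m"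
      using m(2) by simp
    ultimately show ?thesis
      using 3 unfolding u_def[symmetric] expand body
      by (simp add: fps_X_power_mult_nth fps_of_nat[symmetric] del: power_Suc of_nat_Suc)
  qed
qed

theorem theorem4:
  fixes l :: complex and a :: nat
  assumes "l \<noteq> 1"
  shows "let f = fps_X * ((fps_exp 1 - fps_const l) / fps_const (1 - l)) ^ a
    in delta_series f \<and>
       (\<forall>n\<ge>1. associated_sequence f n =
          [:0, 1:] * frobenius_euler (of_nat (a * n)) l (n - 1))"
proof -
  define F where "F = (fps_exp 1 - fps_const l) / fps_const (1 - l)"
  define f where "f = fps_X * F ^ a"
  have F0: "fps_nth F 0 = 1"
    using assms by (simp add: F_def fps_divide_unit)
  have Fa0: "fps_nth (F ^ a) 0 = 1"
    using F0 by (simp add: fps_power_zeroth)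
  have delta: "delta_series f"
    using Fa0 by (simp add: delta_series_def f_def)
  define S where "S n = (if n = 0 then 1
      else [:0, 1:] * frobenius_euler (of_nat (a * n)) l (n - 1))" for n
  have "umbral_pairing (1 * f ^ k) (S n) = (if n = k then fact n else 0)" for n k
  proof (cases "n = 0")
    case True
    then show ?thesis
      by (simp add: S_def umbral_pairing_def f_def fps_power_zeroth)
  next
    case False
    then have n: "n \<ge> 1" by simp
    have "umbral_pairing (1 * f ^ k) (S n) =
        umbral_pairing (fps_deriv (f ^ k)) (frobenius_euler (of_nat (a * n)) l (n - 1))"
      unfolding S_def using False by (simp only: umbral_pairing_X_mult if_False mult_1)
    also have "\<dots> = fact (n - 1) *
        fps_nth (inverse F ^ (a * n) * fps_deriv (f ^ k)) (n - 1)"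
      unfolding F_def
      by (rule umbral_pairing_appell, rule coeff_frobenius_euler_of_nat[OF assms])
    also have "inverse F ^ (a * n) = inverse (F ^ a) ^ n"
      by (simp add: power_mult fps_inverse_power)
    also have "fps_nth (inverse (F ^ a) ^ n * fps_deriv (f ^ k)) (n - 1) =
        (if n = k then of_nat n else 0)"
      unfolding f_def using Fa0 n by (intro fps_power_deriv_residue) simp_all
    finally show ?thesis
      using n by (simp add: fact_reduce)
  qed
  then have "is_sheffer_sequence 1 f S"
    by (simp add: is_sheffer_sequence_def)
  then have "associated_sequence f = S"
    unfolding associated_sequence_def using delta
    by (intro sheffer_sequence_eqI) (simp_all add: invertible_series_def)
  then show ?thesis
    unfolding Let_def F_def[symmetric] f_def[symmetric] using delta by (auto simp: S_def)
qed

end
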